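(* Assume that the dynamics and the feedback operator satisfy the standing structural assumptions listed in the context (linear dissipation, $H$-dissipativity, nonlinearity assumption, feedback operator assumption). Let $\mu>0$ and suppose $$\mu c_0^2h^2<\nu,\qquad \delta:=\frac{\nu\lambda_1}{2}+\frac{\mu}{2}-C_{\mathrm E}>0 .$$ Let $(u_0,v_0)\in\mathbb R^d\times\mathbb R^d$ be arbitrary and let $u,v$ be the corresponding global solutions on $[0,\infty)$ of $$\dot u+\nu Au+N(u)=f,\quad u(0)=u_0,\qquad\qquad \dot v+\nu Av+N(v)=f-\mu(I_hv-I_hu),\quad v(0)=v_0 .$$ Let $T_\ast\ge 0$ and $R_\ast>0$ be constants such that $\|u(t)\|_H,\|v(t)\|_H,\|u(t)\|_V,\|v(t)\|_V\le R_\ast$ for all $t\ge T_\ast$ (such constants exist whenever linear dissipation, $H$-dissipativity, the nonlinearity assumption and the feedback operator assumption hold and $\mu c_0^2h^2<\nu$, $\delta>0$), and let $C_\ast:=C_{R_\ast}$ be the local monotonicity constant of $N$ on the $H$-ball of radius $R_\ast$. If $\mu>2C_\ast$, then for every $t\ge T_\ast$, $$\|v(t)-u(t)\|_H^2\le \exp\bigl(-(\mu-2C_\ast)(t-T_\ast)\bigr)\,\|v(T_\ast)-u(T_\ast)\|_H^2 .$$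
   Context: $H=\mathbb R^d$ with Euclidean inner product $\langle z,z'\rangle_H=z^\top z'$ and norm $\|\cdot\|_H$. $\nu>0$, $f\in\mathbb R^d$, $A\in\mathbb R^{d\times d}$, $N:\mathbb R^d\to\mathbb R^d$. Standing structural assumptions. - Linear dissipation: $A$ is symmetric positive definite; $\lambda_1>0$ is its smallest eigenvalue, and $\|z\|_V:=\sqrt{z^\top Az}$. - $H$-dissipativity: there are $\alpha>0$, $\beta\ge0$ with $\nu z^\top Az+\langle N(z),z\rangle_H\ge \alpha\|z\|_H^2-\beta$ for all $z\in\mathbb R^d$. - Nonlinearity: $N$ is locally Lipschitz; there is $C_{\mathrm E}\ge0$ with $\langle N(z),z\rangle_H\ge -C_{\mathrm E}\|z\|_H^2$ for all $z$; and for every $R>0$ there is a constant $C_R\ge0$ with $-\langle N(z')-N(z),z'-z\rangle_H\le C_R\|z'-z\|_H^2$ whenever $\|z\|_H,\|z'\|_H\le R$ ($C_R$ is the local monotonicity constant). - Feedback operator: for each $h\in[0,1]$, $I_h:\mathbb R^d\to\mathbb R^d$ is linear and $\|z-I_hz\|_H\le c_0h\|z\|_V$ for all $z\in\mathbb R^d$, with $c_0>0$ independent of $z$ and $h$. Here $h\in[0,1]$ is fixed. *)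

theory Defs
  imports "HOL-Analysis.Analysis"
begin

text \<open>The space H is \<open>real ^ 'd\<close> with its library inner product and norm.\<close>

definition is_eigenvalue :: "real ^ 'd ^ 'd \<Rightarrow> real \<Rightarrow> bool" where
  "is_eigenvalue A l \<longleftrightarrow> (\<exists>x. x \<noteq> 0 \<and> A *v x = l *\<^sub>R x)"

definition is_smallest_eigenvalue :: "real ^ 'd ^ 'd \<Rightarrow> real \<Rightarrow> bool" where
  "is_smallest_eigenvalue A l \<longleftrightarrow>
     is_eigenvalue A l \<and> (\<forall>m. is_eigenvalue A m \<longrightarrow> l \<le> m)"

definition symmetric_positive_definite :: "real ^ 'd ^ 'd \<Rightarrow> bool" where
  "symmetric_positive_definite A \<longleftrightarrow>
     transpose A = A \<and> (\<forall>z. z \<noteq> 0 \<longrightarrow> z \<bullet> (A *v z) > 0)"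

definition V_norm :: "real ^ 'd ^ 'd \<Rightarrow> real ^ 'd \<Rightarrow> real" where
  "V_norm A z = sqrt (z \<bullet> (A *v z))"

definition linear_dissipation :: "real ^ 'd ^ 'd \<Rightarrow> real \<Rightarrow> bool" where
  "linear_dissipation A lambda1 \<longleftrightarrow>
     symmetric_positive_definite A \<and> lambda1 > 0 \<and> is_smallest_eigenvalue A lambda1"

definition H_dissipative ::
    "real \<Rightarrow> real ^ 'd ^ 'd \<Rightarrow> (real ^ 'd \<Rightarrow> real ^ 'd) \<Rightarrow> bool" where
  "H_dissipative \<nu> A N \<longleftrightarrow>
     (\<exists>\<alpha> > 0. \<exists>\<beta> \<ge> 0. \<forall>z.
        \<nu> * (z \<bullet> (A *v z)) + N z \<bullet> z \<ge> \<alpha> * (norm z)\<^sup>2 - \<beta>)"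

definition locally_lipschitz_map :: "(real ^ 'd \<Rightarrow> real ^ 'd) \<Rightarrow> bool" where
  "locally_lipschitz_map N \<longleftrightarrow> (\<forall>z. \<exists>r > 0. \<exists>L. L-lipschitz_on (cball z r) N)"

text \<open>\<open>C R\<close> is the local monotonicity constant of \<open>N\<close> on the closed H-ball of radius \<open>R\<close>.\<close>

definition nonlinearity_assumption ::
    "(real ^ 'd \<Rightarrow> real ^ 'd) \<Rightarrow> real \<Rightarrow> (real \<Rightarrow> real) \<Rightarrow> bool" where
  "nonlinearity_assumption N CE C \<longleftrightarrow>
     locally_lipschitz_map N \<and>
     CE \<ge> 0 \<and> (\<forall>z. N z \<bullet> z \<ge> - CE * (norm z)\<^sup>2) \<and>
     (\<forall>R > 0. C R \<ge> 0 \<and>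
        (\<forall>z z'. norm z \<le> R \<longrightarrow> norm z' \<le> R \<longrightarrow>
           - ((N z' - N z) \<bullet> (z' - z)) \<le> C R * (norm (z' - z))\<^sup>2))"

definition feedback_assumption ::
    "real ^ 'd ^ 'd \<Rightarrow> (real \<Rightarrow> real ^ 'd \<Rightarrow> real ^ 'd) \<Rightarrow> real \<Rightarrow> bool" where
  "feedback_assumption A I c0 \<longleftrightarrow>
     c0 > 0 \<and>
     (\<forall>h \<in> {0..1}. linear (I h) \<and> (\<forall>z. norm (z - I h z) \<le> c0 * h * V_norm A z))"

text \<open>Classical solutions on \<open>[0, \<infinity>)\<close>; the derivative at time 0 is one-sided.\<close>

definition reference_solution ::
    "real \<Rightarrow> real ^ 'd ^ 'd \<Rightarrow> (real ^ 'd \<Rightarrow> real ^ 'd) \<Rightarrow> real ^ 'd \<Rightarrow> real ^ 'd \<Rightarrow>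
     (real \<Rightarrow> real ^ 'd) \<Rightarrow> bool" where
  "reference_solution \<nu> A N f u0 u \<longleftrightarrow>
     u 0 = u0 \<and>
     (\<forall>t \<ge> 0. (u has_vector_derivative f - \<nu> *\<^sub>R (A *v u t) - N (u t)) (at t within {0..}))"

definition nudged_solution ::
    "real \<Rightarrow> real ^ 'd ^ 'd \<Rightarrow> (real ^ 'd \<Rightarrow> real ^ 'd) \<Rightarrow> real ^ 'd \<Rightarrow>
     real \<Rightarrow> (real ^ 'd \<Rightarrow> real ^ 'd) \<Rightarrow> (real \<Rightarrow> real ^ 'd) \<Rightarrow> real ^ 'd \<Rightarrow>
     (real \<Rightarrow> real ^ 'd) \<Rightarrow> bool" where
  "nudged_solution \<nu> A N f \<mu> J u v0 v \<longleftrightarrow>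
     v 0 = v0 \<and>
     (\<forall>t \<ge> 0. (v has_vector_derivative
         f - \<mu> *\<^sub>R (J (v t) - J (u t)) - \<nu> *\<^sub>R (A *v v t) - N (v t)) (at t within {0..}))"

definition eventual_bound ::
    "real ^ 'd ^ 'd \<Rightarrow> (real \<Rightarrow> real ^ 'd) \<Rightarrow> (real \<Rightarrow> real ^ 'd) \<Rightarrow> real \<Rightarrow> real \<Rightarrow> bool" where
  "eventual_bound A u v T R \<longleftrightarrow>
     T \<ge> 0 \<and> R > 0 \<and>
     (\<forall>t \<ge> T. norm (u t) \<le> R \<and> norm (v t) \<le> R \<and> V_norm A (u t) \<le> R \<and> V_norm A (v t) \<le> R)"

end

theory Submission
  imports Defs
begin

text \<open>The feedback contributes \<open>- \<mu> w \<bullet> I h w = - \<mu> \<bar>w\<bar>\<^sup>2 + \<mu> w \<bullet> (w - I h w)\<close>, and Young's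
  inequality together with \<open>\<mu> c0\<^sup>2 h\<^sup>2 < \<nu>\<close> absorbs the last term into half of the feedback damping and
  half of the viscous damping. The energy identity for \<open>w = v - u\<close> and the local monotonicity of
  \<open>N\<close> then give \<open>d/dt \<bar>w\<bar>\<^sup>2 \<le> - (\<mu> - 2 C R) \<bar>w\<bar>\<^sup>2\<close>. Boundedness of \<open>u\<close> comes from \<open>H\<close>-dissipativity,
  and that of \<open>v\<close> from the same absorption, the Rayleigh bound
  \<open>lambda1 \<bar>v\<bar>\<^sup>2 \<le> v \<bullet> A v\<close> and \<open>\<delta> > 0\<close>; in finite dimension this also bounds the \<open>V\<close>-norms.\<close>

text \<open>Moving from \<open>x\<close> against \<open>y = B *v x\<close> changes the quadratic
  form by \<open>t * (t * q - 2 * p)\<close>; if \<open>y\<close> were nonzero, the linear term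
  would make the form negative for small \<open>t > 0\<close>.\<close>

lemma psd_null_vector:
  fixes B :: "real ^ 'd ^ 'd"
  assumes sym: "transpose B = B" and psd: "\<And>z. z \<bullet> (B *v z) \<ge> 0" and x: "x \<bullet> (B *v x) = 0"
  shows "B *v x = 0"
proof (rule ccontr)
  assume ne: "B *v x \<noteq> 0"
  define y where "y = B *v x"
  define p where "p = y \<bullet> y"
  define q where "q = y \<bullet> (B *v y)"
  have p: "p > 0" using ne by (simp add: p_def y_def)
  have q: "q \<ge> 0" using psd by (simp add: q_def)
  have xy: "x \<bullet> (B *v y) = p"
    by (metis dot_lmul_matrix p_def sym transpose_matrix_vector y_def)
  have "(x - t *\<^sub>R y) \<bullet> (B *v (x - t *\<^sub>R y)) = t * (t * q - 2 * p)" for t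
    using x xy by (simp add: matrix_vector_mult_diff_distrib matrix_vector_mult_scaleR inner_diff_left
        inner_diff_right p_def q_def y_def[symmetric] algebra_simps)
  then have "t * (t * q - 2 * p) \<ge> 0" for t
    using psd by metis
  \<comment> \<open>For this \<open>t > 0\<close> one has \<open>t * q \<le> p < 2 * p\<close>; the
    \<open>+ 1\<close> keeps the denominator positive when \<open>q = 0\<close>.\<close>
  from this[of "p / (q + 1)"] have "p / (q + 1) * q - 2 * p \<ge> 0"
    using zero_le_mult_iff[of "p / (q + 1)" "p / (q + 1) * q - 2 * p"] divide_pos_pos[of p "q + 1"] p q
    by linarith
  moreover have "p / (q + 1) * q \<le> p" using p q by (simp add: field_simps)
  ultimately show False using p by simp
qed

text \<open>By compactness the form of \<open>A\<close> attains a minimum \<open>m\<close> on the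
  unit sphere. Then \<open>A - m *\<^sub>R mat 1\<close> is positive semidefinite and its form
  vanishes at the minimiser, which is therefore an eigenvector for \<open>m\<close>; hence
  \<open>l \<le> m\<close>.\<close>

lemma Rayleigh_lower_bound:
  fixes A :: "real ^ 'd ^ 'd"
  assumes sym: "transpose A = A" and l: "is_smallest_eigenvalue A l"
  shows "l * (norm z)\<^sup>2 \<le> z \<bullet> (A *v z)"
proof -
  define S where "S = sphere (0 :: real ^ 'd) 1"
  have "\<exists>x\<in>S. \<forall>y\<in>S. x \<bullet> (A *v x) \<le> y \<bullet> (A *v y)"
    unfolding S_def
    by (intro continuous_attains_inf continuous_intros linear_continuous_on
        matrix_vector_mul_bounded_linear) auto
  then obtain x where x: "norm x = 1" and x_min: "\<And>y. norm y = 1 \<Longrightarrow> x \<bullet> (A *v x) \<le> y \<bullet> (A *v y)"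
    by (auto simp: S_def)
  define m where "m = x \<bullet> (A *v x)"
  have min: "m * (norm y)\<^sup>2 \<le> y \<bullet> (A *v y)" for y
  proof (cases "y = 0")
    case False
    have "m \<le> (y /\<^sub>R norm y) \<bullet> (A *v (y /\<^sub>R norm y))"
      unfolding m_def using False by (intro x_min) auto
    also have "\<dots> = (y \<bullet> (A *v y)) / (norm y)\<^sup>2"
      using False by (simp add: matrix_vector_mult_scaleR power2_eq_square field_simps)
    finally show ?thesis using False by (simp add: field_simps)
  qed auto
  define B where "B = A - m *\<^sub>R mat 1"
  have B: "B *v y = A *v y - m *\<^sub>R y" for y
    by (simp add: B_def matrix_vector_mult_diff_rdistrib scaleR_matrix_vector_assoc[symmetric])
  have "transpose B = B"
    using sym by (simp add: B_def transpose_def mat_def vec_eq_iff eq_commute)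
  moreover have "y \<bullet> (B *v y) \<ge> 0" for y
    using min[of y] by (simp add: B inner_diff_right power2_norm_eq_inner)
  moreover have "x \<bullet> (B *v x) = 0"
    using x by (simp add: B inner_diff_right m_def norm_eq_1)
  ultimately have "B *v x = 0" by (rule psd_null_vector)
  then have "is_eigenvalue A m"
    using x by (auto simp: B is_eigenvalue_def intro!: exI[of _ x])
  then have "l \<le> m" using l by (simp add: is_smallest_eigenvalue_def)
  then show ?thesis using min[of z] mult_right_mono[of l m "(norm z)\<^sup>2"] by simp
qed

text \<open>The integrating factor makes \<open>exp (a * s) * ((norm (w s))\<^sup>2 - b / a)\<close>
  nonincreasing. Taking \<open>b = 0\<close> gives pure exponential decay, \<open>b \<ge> 0\<close>
  with \<open>a > 0\<close> a uniform bound.\<close>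

lemma energy_gronwall:
  fixes w w' :: "real \<Rightarrow> 'a :: real_inner"
  assumes t: "T \<le> t" and a: "a \<noteq> 0"
    and der: "\<And>s. s \<ge> T \<Longrightarrow> (w has_vector_derivative w' s) (at s within {T..})"
    and le: "\<And>s. s \<ge> T \<Longrightarrow> 2 * (w s \<bullet> w' s) \<le> b - a * (norm (w s))\<^sup>2"
  shows "(norm (w t))\<^sup>2 \<le> b / a + exp (- a * (t - T)) * ((norm (w T))\<^sup>2 - b / a)"
proof -
  define g where "g s = exp (a * s) * (w s \<bullet> w s - b / a)" for s
  define g' where "g' s = exp (a * s) * (2 * (w s \<bullet> w' s) + a * (w s \<bullet> w s) - b)" for s
  have "(g has_real_derivative g' s) (at s within {T..t})" if "s \<in> {T..t}" for s
  proof -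
    have [derivative_intros]: "(w has_derivative (\<lambda>h. h *\<^sub>R w' s)) (at s within {T..t})"
      using der[of s] that unfolding has_vector_derivative_def
      by (auto intro: has_derivative_subset)
    show ?thesis unfolding g_def g'_def has_field_derivative_def
      by (rule derivative_eq_intros refl)+
        (use a in \<open>auto simp: fun_eq_iff algebra_simps inner_commute\<close>)
  qed
  \<comment> \<open>This form of the mean value theorem works with derivatives within the closed
    interval and includes the case \<open>t = T\<close>.\<close>
  then have "\<exists>s\<in>{T..t}. g t - g T = (t - T) * g' s"
    using mvt_very_simple[of T t g "\<lambda>s h. g' s * h"] t
    by (auto simp: has_field_derivative_def mult.commute[of "t - T"])
  moreover have "g' s \<le> 0" if "s \<ge> T" for s
    using le[OF that] by (simp add: g'_def mult_le_0_iff power2_norm_eq_inner)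
  ultimately obtain s where "g t - g T = (t - T) * g' s" and "g' s \<le> 0"
    by (meson atLeastAtMost_iff)
  then have "g t \<le> g T"
    using t mult_nonneg_nonpos[of "t - T" "g' s"] by simp
  then have "exp (- a * t) * g t \<le> exp (- a * t) * g T" by simp
  moreover have "exp (- a * t) * g s = exp (- a * (t - s)) * ((norm (w s))\<^sup>2 - b / a)" for s
  proof -
    have "exp (- a * (t - s)) = exp (- a * t) * exp (a * s)"
      unfolding exp_add[symmetric] by (simp add: right_diff_distrib)
    then show ?thesis by (simp add: g_def power2_norm_eq_inner)
  qed
  ultimately have "exp (- a * (t - t)) * ((norm (w t))\<^sup>2 - b / a)
      \<le> exp (- a * (t - T)) * ((norm (w T))\<^sup>2 - b / a)"
    by metis
  then show ?thesis by (simp only: diff_self mult_zero_right exp_zero mult_1_left diff_le_eq add.commute)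
qed

lemma energy_bounded:
  fixes w w' :: "real \<Rightarrow> 'a :: real_inner"
  assumes a: "a > 0" and b: "b \<ge> 0"
    and der: "\<And>s. s \<ge> T \<Longrightarrow> (w has_vector_derivative w' s) (at s within {T..})"
    and le: "\<And>s. s \<ge> T \<Longrightarrow> w s \<bullet> w' s \<le> b + g s \<bullet> w s - a * (norm (w s))\<^sup>2"
    and g: "\<And>s. s \<ge> T \<Longrightarrow> norm (g s) \<le> G"
  obtains M where "\<And>t. t \<ge> T \<Longrightarrow> norm (w t) \<le> M"
proof
  \<comment> \<open>Doubling the energy inequality gives damping \<open>2 * a\<close>; Young's
    inequality spends one \<open>a\<close> on the forcing, at the cost
    \<open>G\<^sup>2 / a\<close>.\<close>
  define c where "c = 2 * b + G\<^sup>2 / a"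
  fix t assume t: "t \<ge> T"
  have c: "c \<ge> 0" using a b by (simp add: c_def)
  have "2 * (w s \<bullet> w' s) \<le> c - a * (norm (w s))\<^sup>2" if s: "s \<ge> T" for s
  proof -
    have "2 * (g s \<bullet> w s) \<le> 2 * (G * norm (w s))"
      using Cauchy_Schwarz_ineq2[of "g s" "w s"] mult_right_mono[OF g[OF s], of "norm (w s)"] by simp
    also have "\<dots> \<le> G\<^sup>2 / a + a * (norm (w s))\<^sup>2"
    proof -
      have "0 \<le> (G - a * norm (w s))\<^sup>2 / a" using a by simp
      also have "\<dots> = G\<^sup>2 / a + a * (norm (w s))\<^sup>2 - 2 * (G * norm (w s))"
        using a by (simp add: field_simps power2_eq_square)
      finally show ?thesis by simp
    qed
    finally show ?thesis using le[OF s] by (simp add: c_def)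
  qed
  then have "(norm (w t))\<^sup>2 \<le> c / a + exp (- a * (t - T)) * ((norm (w T))\<^sup>2 - c / a)"
    using a t der by (intro energy_gronwall) auto
  also have "\<dots> \<le> c / a + exp (- a * (t - T)) * (norm (w T))\<^sup>2"
    using a c by simp
  also have "\<dots> \<le> c / a + (norm (w T))\<^sup>2"
    using a t by (simp add: mult_left_le_one_le)
  finally show "norm (w t) \<le> sqrt (c / a + (norm (w T))\<^sup>2)"
    by (simp add: real_le_rsqrt)
qed

lemma V_norm_le:
  fixes A :: "real ^ 'd ^ 'd"
  shows "V_norm A z \<le> sqrt (onorm ((*v) A)) * norm z"
proof -
  have "z \<bullet> (A *v z) \<le> norm z * norm (A *v z)" by (rule norm_cauchy_schwarz)
  also have "\<dots> \<le> norm z * (onorm ((*v) A) * norm z)"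
    by (intro mult_left_mono onorm matrix_vector_mul_bounded_linear) auto
  finally have "V_norm A z \<le> sqrt (onorm ((*v) A) * (norm z)\<^sup>2)"
    by (simp add: V_norm_def power2_eq_square mult_ac)
  then show ?thesis by (simp add: real_sqrt_mult)
qed

text \<open>Applied to \<open>v\<close> for boundedness and to \<open>v - u\<close> for decay. Equal
  weights in Young's inequality produce the two factors 1/2.\<close>

lemma feedback_coercive:
  fixes A :: "real ^ 'd ^ 'd"
  assumes "symmetric_positive_definite A" and "\<mu> > 0" and "\<mu> * c0\<^sup>2 * h\<^sup>2 \<le> \<nu>"
    and J: "\<And>z. norm (z - J z) \<le> c0 * h * V_norm A z"
  shows "\<mu> / 2 * (norm z)\<^sup>2 \<le> \<mu> * (J z \<bullet> z) + \<nu> / 2 * (z \<bullet> (A *v z))"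
proof -
  have V: "z \<bullet> (A *v z) \<ge> 0"
    using assms(1) by (cases "z = 0") (auto simp: symmetric_positive_definite_def less_imp_le)
  have "2 * ((z - J z) \<bullet> z) \<le> (norm (z - J z))\<^sup>2 + (norm z)\<^sup>2"
    using norm_cauchy_schwarz[of "z - J z" z] sum_squares_bound[of "norm (z - J z)" "norm z"] by simp
  also have "(norm (z - J z))\<^sup>2 \<le> (c0 * h * V_norm A z)\<^sup>2"
    by (intro power_mono J) auto
  also have "\<dots> = c0\<^sup>2 * h\<^sup>2 * (z \<bullet> (A *v z))"
    using V by (simp add: V_norm_def power_mult_distrib)
  finally have "\<mu> * (2 * ((z - J z) \<bullet> z)) \<le> \<mu> * (c0\<^sup>2 * h\<^sup>2 * (z \<bullet> (A *v z)) + (norm z)\<^sup>2)"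
    using \<open>\<mu> > 0\<close> by (intro mult_left_mono) auto
  moreover have "\<mu> * c0\<^sup>2 * h\<^sup>2 * (z \<bullet> (A *v z)) \<le> \<nu> * (z \<bullet> (A *v z))"
    using assms(3) V by (rule mult_right_mono)
  ultimately show ?thesis
    by (simp add: inner_diff_left power2_norm_eq_inner algebra_simps)
qed

theorem theorem2p15:
  fixes A :: "real ^ 'd ^ 'd"
    and N :: "real ^ 'd \<Rightarrow> real ^ 'd"
    and I :: "real \<Rightarrow> real ^ 'd \<Rightarrow> real ^ 'd"
    and C :: "real \<Rightarrow> real"
    and f u0 v0 :: "real ^ 'd"
    and u v :: "real \<Rightarrow> real ^ 'd"
    and \<nu> \<mu> \<delta> lambda1 CE c0 h :: real
  assumes "\<nu> > 0"
    and "linear_dissipation A lambda1"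
    and "H_dissipative \<nu> A N"
    and "nonlinearity_assumption N CE C"
    and "feedback_assumption A I c0"
    and "h \<in> {0..1}"
    and "\<mu> > 0"
    and "\<mu> * c0\<^sup>2 * h\<^sup>2 < \<nu>"
    and "\<delta> = \<nu> * lambda1 / 2 + \<mu> / 2 - CE"
    and "\<delta> > 0"
    and "reference_solution \<nu> A N f u0 u"
    and "nudged_solution \<nu> A N f \<mu> (I h) u v0 v"
  shows "(\<exists>T R. eventual_bound A u v T R) \<and>
    (\<forall>T R. eventual_bound A u v T R \<longrightarrow> \<mu> > 2 * C R \<longrightarrow>
       (\<forall>t \<ge> T. (norm (v t - u t))\<^sup>2
          \<le> exp (- (\<mu> - 2 * C R) * (t - T)) * (norm (v T - u T))\<^sup>2))"
proof -
  have spd: "symmetric_positive_definite A" and sym: "transpose A = A"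
    and Ray: "\<And>z. lambda1 * (norm z)\<^sup>2 \<le> z \<bullet> (A *v z)"
    using assms(2) Rayleigh_lower_bound
    by (auto simp: linear_dissipation_def symmetric_positive_definite_def)
  have lin: "linear (I h)" and I: "\<And>z. norm (z - I h z) \<le> c0 * h * V_norm A z"
    using assms(5,6) by (auto simp: feedback_assumption_def)
  have coercive: "\<mu> / 2 * (norm z)\<^sup>2 \<le> \<mu> * (I h z \<bullet> z) + \<nu> / 2 * (z \<bullet> (A *v z))" for z
    using feedback_coercive[OF spd _ _ I] assms(7,8) by simp
  have CE: "N z \<bullet> z \<ge> - CE * (norm z)\<^sup>2" for z
    using assms(4) by (auto simp: nonlinearity_assumption_def)
  define u' where "u' t = f - \<nu> *\<^sub>R (A *v u t) - N (u t)" for t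
  define v' where "v' t = f - \<mu> *\<^sub>R (I h (v t) - I h (u t)) - \<nu> *\<^sub>R (A *v v t) - N (v t)" for t
  have u: "(u has_vector_derivative u' t) (at t within {0..})" if "t \<ge> 0" for t
    using assms(11) that by (simp add: reference_solution_def u'_def)
  have v: "(v has_vector_derivative v' t) (at t within {0..})" if "t \<ge> 0" for t
    using assms(12) that by (simp add: nudged_solution_def v'_def)

  obtain \<alpha> \<beta> where ab: "\<alpha> > 0" "\<beta> \<ge> 0"
    and diss: "\<And>z. \<nu> * (z \<bullet> (A *v z)) + N z \<bullet> z \<ge> \<alpha> * (norm z)\<^sup>2 - \<beta>"
    using assms(3) by (auto simp: H_dissipative_def)
  have "u t \<bullet> u' t \<le> \<beta> + f \<bullet> u t - \<alpha> * (norm (u t))\<^sup>2" for t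
    using diss[of "u t"] by (simp add: u'_def inner_diff_right inner_commute)
  \<comment> \<open>The forcing is the constant \<open>f\<close>, so \<open>order.refl\<close>
    selects \<open>G = norm f\<close>.\<close>
  from energy_bounded[OF ab u this order.refl]
  obtain Mu where Mu: "\<And>t. t \<ge> 0 \<Longrightarrow> norm (u t) \<le> Mu" by blast

  have "v t \<bullet> v' t \<le> 0 + (f + \<mu> *\<^sub>R I h (u t)) \<bullet> v t - \<delta> * (norm (v t))\<^sup>2" for t
  proof -
    \<comment> \<open>The feedback consumes half of the viscous term, so the bound with
      \<open>CE\<close> replaces dissipativity, which requires all of it. The other half becomes
      \<open>\<nu> * lambda1 / 2\<close>, and the rates add up to \<open>\<delta>\<close>. The term
      with \<open>I h (u t)\<close> counts as forcing, bounded because \<open>u\<close> is.\<close>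
    have "\<nu> * (lambda1 * (norm (v t))\<^sup>2) \<le> \<nu> * (v t \<bullet> (A *v v t))"
      using Ray assms(1) by simp
    then show ?thesis
      using coercive[of "v t"] CE[of "v t"] unfolding assms(9)
      by (simp add: v'_def inner_diff_right inner_diff_left inner_add_right inner_add_left
          inner_commute field_simps)
  qed
  moreover have "norm (f + \<mu> *\<^sub>R I h (u t)) \<le> norm f + \<mu> * (onorm (I h) * Mu)" if "t \<ge> 0" for t
  proof -
    have bl: "bounded_linear (I h)" using lin by (simp add: linear_linear)
    have "norm (I h (u t)) \<le> onorm (I h) * norm (u t)" by (rule onorm[OF bl])
    also have "\<dots> \<le> onorm (I h) * Mu"
      using Mu[OF that] onorm_pos_le[OF bl] by (rule mult_left_mono)
    finally have "norm (\<mu> *\<^sub>R I h (u t)) \<le> \<mu> * (onorm (I h) * Mu)"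
      using assms(7) by simp
    then show ?thesis by (intro order.trans[OF norm_triangle_ineq]) simp
  qed
  ultimately obtain Mv where Mv: "\<And>t. t \<ge> 0 \<Longrightarrow> norm (v t) \<le> Mv"
    using energy_bounded[OF \<open>\<delta> > 0\<close> order.refl v, of "\<lambda>t. f + \<mu> *\<^sub>R I h (u t)"] by blast

  define K where "K = sqrt (onorm ((*v) A))"
  \<comment> \<open>The \<open>+ 1\<close> ensures \<open>M > 0\<close>, as the radius must be
    positive; \<open>(K + 1) * M\<close> then dominates both the H-bound \<open>M\<close> and the
    V-bound \<open>K * M\<close>.\<close>
  define M where "M = \<bar>Mu\<bar> + \<bar>Mv\<bar> + 1"
  have K: "K \<ge> 0" by (simp add: K_def onorm_pos_le)
  have "M > 0" by (simp add: M_def)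
  then have M: "M \<le> (K + 1) * M" "K * M \<le> (K + 1) * M" "(K + 1) * M > 0"
    using K by (simp_all add: distrib_right add_nonneg_pos)
  have V: "V_norm A z \<le> (K + 1) * M" if "norm z \<le> M" for z
    using V_norm_le[of A z] mult_left_mono[OF that K] M by (simp add: K_def)
  have "norm (u t) \<le> M \<and> norm (v t) \<le> M" if "t \<ge> 0" for t
    using Mu[OF that] Mv[OF that] unfolding M_def by (intro conjI; linarith)
  then have "norm (u t) \<le> (K + 1) * M \<and> norm (v t) \<le> (K + 1) * M
      \<and> V_norm A (u t) \<le> (K + 1) * M \<and> V_norm A (v t) \<le> (K + 1) * M" if "t \<ge> 0" for t
    using that V M(1) order.trans by blast
  then have "eventual_bound A u v 0 ((K + 1) * M)"
    unfolding eventual_bound_def using M(3) by blast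
  moreover have "(norm (v t - u t))\<^sup>2 \<le> exp (- (\<mu> - 2 * C R) * (t - T)) * (norm (v T - u T))\<^sup>2"
    if bd: "eventual_bound A u v T R" and pos: "\<mu> > 2 * C R" and t: "t \<ge> T" for T R t
  proof -
    have T: "T \<ge> 0" using bd by (simp add: eventual_bound_def)
    \<comment> \<open>From time \<open>T\<close> on both solutions stay in the ball of radius
      \<open>R\<close>, where the constant \<open>C R\<close> is valid.\<close>
    have mono: "- ((N (v s) - N (u s)) \<bullet> (v s - u s)) \<le> C R * (norm (v s - u s))\<^sup>2"
      if "s \<ge> T" for s
      using bd assms(4) that by (auto simp: eventual_bound_def nonlinearity_assumption_def)
    have "2 * ((v s - u s) \<bullet> (v' s - u' s)) \<le> 0 - (\<mu> - 2 * C R) * (norm (v s - u s))\<^sup>2"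
      if s: "s \<ge> T" for s
    proof -
      define w where "w = v s - u s"
      \<comment> \<open>The force \<open>f\<close> cancels, and linearity of \<open>I h\<close>
        turns the feedback into a function of \<open>w\<close> alone.\<close>
      have w': "v' s - u' s = - (\<mu> *\<^sub>R I h w) - \<nu> *\<^sub>R (A *v w) - (N (v s) - N (u s))"
        by (simp add: v'_def u'_def w_def linear_diff[OF lin] matrix_vector_mult_diff_distrib
            algebra_simps)
      \<comment> \<open>The viscous half left over by \<open>coercive\<close> is dropped by sign.
        Doubling turns the damping \<open>\<mu> / 2\<close> into \<open>\<mu>\<close> and the
        monotonicity loss into \<open>2 * C R\<close>.\<close>
      have "0 \<le> \<nu> * (w \<bullet> (A *v w))"
        using spd assms(1)
        by (cases "w = 0") (auto simp: symmetric_positive_definite_def less_imp_le)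
      then show ?thesis
        using coercive[of w] mono[OF s] unfolding w' w_def[symmetric]
        by (simp add: inner_diff_right inner_commute algebra_simps)
    qed
    moreover have "((\<lambda>t. v t - u t) has_vector_derivative v' s - u' s) (at s within {T..})"
      if "s \<ge> T" for s
      using that T
      by (intro has_vector_derivative_within_subset[OF has_vector_derivative_diff[OF v u]]) auto
    ultimately show ?thesis
      using energy_gronwall[of T t "\<mu> - 2 * C R" "\<lambda>t. v t - u t" "\<lambda>t. v' t - u' t" 0] t pos
      by simp
  qed
  ultimately show ?thesis by blast
qed

end
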